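(* Consider the Zeckendorf game on $n$ with $p$ players and let $A$ be an alliance (set of players) containing more than two-thirds of the players. Suppose there is an integer $b$ such that whenever player $i$ is not in $A$, player $(i-b) \bmod p$ is in $A$, and suppose $A$ contains at least $2b$ cyclically consecutive players. If $n \geq 4pb+2p-2b$, then $A$ has a winning strategy.
   Context: Let $F_1=1$, $F_2=2$, $F_{i+1}=F_i+F_{i-1}$. The Zeckendorf game on $n$ starts with the multiset of $n$ copies of $1$. A move is one of: if the list contains $F_{i-1}$ and $F_i$, replace them by $F_{i+1}$; if the list contains two copies of $F_i$: for $i=1$ replace them by $F_2$; for $i=2$ replace them by $F_1,F_3$; for $i\geq 3$ replace them by $F_{i-2},F_{i+1}$. The game ends when the list is the Zeckendorf decomposition of $n$ (distinct, pairwise non-consecutive Fibonacci numbers); every game terminates. With $p$ players, players $1,\dots,p$ (indices taken mod $p$) move in cyclic order $1,2,\dots,p,1,2,\dots$ starting with player 1; players $i$ and $i+1 \pmod p$ are consecutive. An alliance wins if the final move (creating the Zeckendorf decomposition) is made by one of its members; it has a winning strategy if its members can choose their moves so that the final move is made by a member no matter what moves the other players make.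
   Formalization: The integer b is taken to be nonnegative; for negative b the claim is false as stated (e.g. p=4, b=-1, A={2,3,4}, n=2: player 1, outside A, makes the only move). *)

theory Defs
  imports "HOL-Library.Multiset" "HOL-Number_Theory.Fib"
begin

text \<open>The library has \<open>fib 1 = fib 2 = 1\<close>; the shift gives \<open>zfib 1 = 1\<close>, \<open>zfib 2 = 2\<close>.
  Only indices \<open>i \<ge> 1\<close> are meaningful (\<open>zfib 0 = zfib 1\<close>).\<close>

definition zfib :: "nat \<Rightarrow> nat" where
  "zfib i = fib (Suc i)"

definition zeck_start :: "nat \<Rightarrow> nat multiset" where
  "zeck_start n = replicate_mset n (zfib 1)"

inductive zeck_move :: "nat multiset \<Rightarrow> nat multiset \<Rightarrow> bool" where
  combine: "i \<ge> 2 \<Longrightarrow> zeck_move (M + {#zfib (i - 1), zfib i#}) (M + {#zfib (i + 1)#})"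
| merge_ones: "zeck_move (M + {#zfib 1, zfib 1#}) (M + {#zfib 2#})"
| split_twos: "zeck_move (M + {#zfib 2, zfib 2#}) (M + {#zfib 1, zfib 3#})"
| split: "i \<ge> 3 \<Longrightarrow> zeck_move (M + {#zfib i, zfib i#}) (M + {#zfib (i - 2), zfib (i + 1)#})"

definition zeckendorf_decomposition :: "nat \<Rightarrow> nat multiset \<Rightarrow> bool" where
  "zeckendorf_decomposition n M \<longleftrightarrow>
     (\<exists>I. finite I \<and> 0 \<notin> I \<and> (\<forall>i\<in>I. Suc i \<notin> I) \<and> M = mset_set (zfib ` I)) \<and> sum_mset M = n"

text \<open>The representative of \<open>k\<close> modulo \<open>p\<close> in \<open>{1..p}\<close> (for \<open>p \<ge> 1\<close>). The \<open>t\<close>-th move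
  of the game, \<open>t = 1, 2, \<dots>\<close>, is made by \<open>player p t\<close>.\<close>

definition player :: "nat \<Rightarrow> int \<Rightarrow> nat" where
  "player p k = nat ((k - 1) mod int p) + 1"

text \<open>A possibly unfinished play, as the list of positions from the initial one to the current
  one; the move from \<open>ps ! (t - 1)\<close> to \<open>ps ! t\<close> is the \<open>t\<close>-th one. Zeckendorf decompositions
  admit no move, so no play continues past the end of the game.\<close>

definition zeck_play :: "nat \<Rightarrow> nat multiset list \<Rightarrow> bool" where
  "zeck_play n ps \<longleftrightarrow> ps \<noteq> [] \<and> hd ps = zeck_start n \<and> successively zeck_move ps"

text \<open>A joint strategy of an alliance maps the play so far to the next position.\<close>

type_synonym strategy = "nat multiset list \<Rightarrow> nat multiset"

definition follows_strategy :: "nat \<Rightarrow> nat set \<Rightarrow> strategy \<Rightarrow> nat multiset list \<Rightarrow> bool" where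
  "follows_strategy p A \<sigma> ps \<longleftrightarrow>
     (\<forall>t. 1 \<le> t \<and> t < length ps \<and> player p (int t) \<in> A \<longrightarrow> ps ! t = \<sigma> (take t ps))"

text \<open>The first conjunct of the conclusion forces \<open>\<sigma>\<close> to make legal moves; without it a
  strategy could win vacuously. In the second, \<open>length ps > 1\<close> says that a final move was
  actually made.\<close>

definition winning_strategy :: "nat \<Rightarrow> nat \<Rightarrow> nat set \<Rightarrow> strategy \<Rightarrow> bool" where
  "winning_strategy n p A \<sigma> \<longleftrightarrow>
     (\<forall>ps. zeck_play n ps \<and> follows_strategy p A \<sigma> ps \<longrightarrow>
        (\<not> zeckendorf_decomposition n (last ps) \<and> player p (int (length ps)) \<in> A
           \<longrightarrow> zeck_move (last ps) (\<sigma> ps)) \<and>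
        (zeckendorf_decomposition n (last ps)
           \<longrightarrow> length ps > 1 \<and> player p (int (length ps - 1)) \<in> A))"

definition has_winning_strategy :: "nat \<Rightarrow> nat \<Rightarrow> nat set \<Rightarrow> bool" where
  "has_winning_strategy n p A \<longleftrightarrow> (\<exists>\<sigma>. winning_strategy n p A \<sigma>)"

definition contains_consecutive :: "nat \<Rightarrow> nat set \<Rightarrow> nat \<Rightarrow> bool" where
  "contains_consecutive p A m \<longleftrightarrow> (\<exists>s::int. \<forall>j<m. player p (s + int j) \<in> A)"

end

theory Submission
  imports Defs
begin

text \<open>
  Call a position with a given turn lost if the players outside \<open>A\<close> can force the final move.
  The hypothesis on \<open>b\<close> lets \<open>A\<close> steal strategies: if \<open>M\<close> is lost when player \<open>s\<close> is to move,
  then \<open>A\<close> can pretend that every player is shifted by \<open>b\<close> and imitate its opponents, so \<open>M\<close>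
  is not lost when player \<open>s - b\<close> is to move. If the initial position were lost, \<open>A\<close> could
  keep merging ones. As \<open>A\<close> has more than twice as many members as there are other players,
  and a move removes at most two twos, the number of twos grows in every round, so that after
  \<open>b\<close> rounds the block of \<open>2 * b\<close> consecutive members of \<open>A\<close> finds at least \<open>b\<close> twos. It can
  then turn \<open>b\<close> pairs \<open>1, 2\<close> into threes either in \<open>b\<close> moves \<open>1, 2 \<rightarrow> 3\<close> or in \<open>2 * b\<close> moves,
  alternating \<open>1, 1 \<rightarrow> 2\<close> and \<open>2, 2 \<rightarrow> 1, 3\<close>. Thus the same position is lost for two turns
  that differ by \<open>b\<close>, a contradiction.
\<close>

subsection \<open>Positions and moves\<close>

lemma zfib_small: "zfib (Suc 0) = 1" "zfib 2 = 2" "zfib 3 = 3"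
  by (simp_all add: zfib_def numeral_eq_Suc)

lemma zfib_strict_mono_on: "strict_mono_on {1..} zfib"
proof (rule strict_mono_onI)
  fix i j :: nat
  assume i: "i \<in> {1..}" and "i < j"
  have "zfib i < zfib (Suc i)"
    using i fib_neq_0_nat[of i] by (simp add: zfib_def)
  also have "\<dots> \<le> zfib j"
    using \<open>i < j\<close> unfolding zfib_def by (intro fib_mono) simp
  finally show "zfib i < zfib j" .
qed

lemma inj_on_zfib: "inj_on zfib {1..}"
  using zfib_strict_mono_on by (rule strict_mono_on_imp_inj_on)

lemma zfib_eq_iff: "1 \<le> i \<Longrightarrow> 1 \<le> j \<Longrightarrow> zfib i = zfib j \<longleftrightarrow> i = j"
  using inj_on_zfib by (auto dest: inj_onD)

lemma zfib_add_consecutive: "2 \<le> i \<Longrightarrow> zfib (i - 1) + zfib i = zfib (i + 1)"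
  by (cases i) (auto simp: zfib_def)

lemma zfib_double: "3 \<le> i \<Longrightarrow> 2 * zfib i = zfib (i - 2) + zfib (i + 1)"
  by (auto dest!: le_Suc_ex simp: zfib_def numeral_eq_Suc)

lemma zeck_move_sum: "zeck_move M N \<Longrightarrow> sum_mset N = sum_mset M"
proof (induction rule: zeck_move.induct)
  case (combine i M)
  then show ?case using zfib_add_consecutive[of i] by simp
next
  case (split i M)
  then show ?case using zfib_double[of i] by simp
qed (simp_all add: zfib_small)

lemma zeck_move_zfib:
  "zeck_move M N \<Longrightarrow> set_mset M \<subseteq> zfib ` {1..} \<Longrightarrow> set_mset N \<subseteq> zfib ` {1..}"
  by (induction rule: zeck_move.induct) auto

lemma zeck_move_count:
  assumes "zeck_move M N"
  shows "count M x \<le> count N x + 2"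
  using assms by (induction rule: zeck_move.induct) auto

text \<open>Every rule tolerates extra terms, so a move can be exhibited on just the terms that it
  consumes.\<close>

lemma zeck_moveI:
  assumes "zeck_move R S" "R \<subseteq># M"
  shows "zeck_move M (M - R + S)"
proof -
  have "zeck_move (K + R) (K + S)" for K
    using assms(1)
  proof cases
    case (combine i L)
    then show ?thesis using zeck_move.combine[of i "K + L"] by (simp add: ac_simps)
  next
    case (merge_ones L)
    then show ?thesis using zeck_move.merge_ones[of "K + L"] by (simp add: ac_simps)
  next
    case (split_twos L)
    then show ?thesis using zeck_move.split_twos[of "K + L"] by (simp add: ac_simps)
  next
    case (split i L)
    then show ?thesis using zeck_move.split[of i "K + L"] by (simp add: ac_simps)
  qed
  from this[of "M - R"] show ?thesis using assms(2) by simp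
qed

lemma zeck_move_combine: "2 \<le> i \<Longrightarrow> zeck_move {#zfib (i - 1), zfib i#} {#zfib (i + 1)#}"
  using zeck_move.combine[of i "{#}"] by simp

lemma zeck_move_ones: "zeck_move {#1, 1#} {#2#}"
  using zeck_move.merge_ones[of "{#}"] by (simp add: zfib_small)

lemma zeck_move_one_two: "zeck_move {#1, 2#} {#3#}"
  using zeck_move_combine[of 2] by (simp add: zfib_small)

lemma zeck_move_twos: "zeck_move {#2, 2#} {#1, 3#}"
  using zeck_move.split_twos[of "{#}"] by (simp add: zfib_small)

lemma zeck_move_pair:
  assumes "1 \<le> i"
  shows "\<exists>S. zeck_move {#zfib i, zfib i#} S"
proof -
  consider "i = 1" | "i = 2" | "3 \<le> i" using assms by linarith
  then show ?thesis
  proof cases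
    case 3
    then show ?thesis using zeck_move.split[of i "{#}"] by auto
  qed (use zeck_move_ones zeck_move_twos in \<open>auto simp: zfib_small\<close>)
qed

lemma decomposition_no_move:
  assumes "zeckendorf_decomposition n M"
  shows "\<not> zeck_move M N"
proof
  assume move: "zeck_move M N"
  obtain I where I: "finite I" "0 \<notin> I" "\<And>i. i \<in> I \<Longrightarrow> Suc i \<notin> I" "M = mset_set (zfib ` I)"
    using assms unfolding zeckendorf_decomposition_def by blast
  have le1: "count M x \<le> 1" for x
    using I(1,4) by (simp add: count_mset_set')
  have mem: "i \<in> I" if "zfib i \<in># M" "1 \<le> i" for i
  proof -
    from that(1) obtain j where "j \<in> I" "zfib i = zfib j" using I(1,4) by auto
    moreover from this I(2) have "1 \<le> j" by (cases j) auto
    ultimately show ?thesis using that(2) by (simp add: zfib_eq_iff)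
  qed
  show False
    using move
  proof cases
    case (combine i K)
    then have "i - 1 \<in> I" "i \<in> I" by (auto intro!: mem)
    then show False using I(3)[of "i - 1"] combine by simp
  next
    case (merge_ones K)
    then show False using le1[of "zfib 1"] by simp
  next
    case (split_twos K)
    then show False using le1[of "zfib 2"] by simp
  next
    case (split i K)
    then show False using le1[of "zfib i"] by simp
  qed
qed

text \<open>A repeated term or two adjacent ones would admit a move. With
  \<open>decomposition_no_move\<close>, the final positions are exactly the stuck ones, so
  \<open>forced_loss\<close> need only speak of these.\<close>

lemma decomposition_or_move:
  assumes M: "set_mset M \<subseteq> zfib ` {1..}" and stuck: "\<And>N. \<not> zeck_move M N"
  shows "zeckendorf_decomposition (sum_mset M) M"
proof -
  define I where "I = {i. 1 \<le> i \<and> zfib i \<in># M}"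
  have image: "zfib ` I = set_mset M"
    using M by (auto simp: I_def)
  have "inj_on zfib I"
    using inj_on_zfib by (rule inj_on_subset) (auto simp: I_def)
  then have "finite I"
    using image by (metis finite_imageD finite_set_mset)
  moreover have "0 \<notin> I"
    by (simp add: I_def)
  moreover have "Suc i \<notin> I" if i: "i \<in> I" for i
  proof
    assume "Suc i \<in> I"
    then have "{#zfib i, zfib (Suc i)#} \<subseteq># M"
      using i by (auto simp: I_def zfib_eq_iff insert_subset_eq_iff in_diff_count)
    moreover have "zeck_move {#zfib i, zfib (Suc i)#} {#zfib (i + 2)#}"
      using i zeck_move_combine[of "Suc i"] by (simp add: I_def)
    ultimately show False using stuck zeck_moveI by blast
  qed
  moreover have "M = mset_set (zfib ` I)"
  proof (rule multiset_eqI)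
    fix x
    have "count M x \<le> 1"
    proof (rule ccontr)
      assume many: "\<not> count M x \<le> 1"
      then have "x \<in># M" by (metis le_zero_eq linear not_in_iff zero_le_one)
      then obtain i where i: "1 \<le> i" "x = zfib i" using M by auto
      have "{#x, x#} \<subseteq># M"
        using many by (auto simp: subseteq_mset_def)
      then show False using zeck_move_pair[OF i(1)] i(2) stuck zeck_moveI by blast
    qed
    moreover have "count M x = 0 \<longleftrightarrow> x \<notin># M" by (simp add: not_in_iff)
    ultimately show "count M x = count (mset_set (zfib ` I)) x"
      unfolding image by (auto simp: count_mset_set' le_Suc_eq)
  qed
  ultimately show ?thesis
    unfolding zeckendorf_decomposition_def by blast
qed

subsection \<open>Lost positions\<close>

text \<open>Here \<open>t\<close> is the index of the move about to be made from \<open>M\<close>, so \<open>player p (t - 1)\<close> made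
  the previous one. Since only finite plays count against \<open>A\<close>, an inductive definition suffices
  and termination of the game is irrelevant.\<close>

inductive forced_loss :: "nat \<Rightarrow> nat set \<Rightarrow> nat multiset \<Rightarrow> int \<Rightarrow> bool" for p A where
  ended: "(\<And>N. \<not> zeck_move M N) \<Longrightarrow> player p (t - 1) \<notin> A \<Longrightarrow> forced_loss p A M t"
| alliance: "zeck_move M N \<Longrightarrow> player p t \<in> A \<Longrightarrow>
    (\<And>N. zeck_move M N \<Longrightarrow> forced_loss p A N (t + 1)) \<Longrightarrow> forced_loss p A M t"
| opponent: "zeck_move M N \<Longrightarrow> player p t \<notin> A \<Longrightarrow> forced_loss p A N (t + 1) \<Longrightarrow>
    forced_loss p A M t"

lemma forced_loss_alliance:
  "forced_loss p A M t \<Longrightarrow> player p t \<in> A \<Longrightarrow> zeck_move M N \<Longrightarrow> forced_loss p A N (t + 1)"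
  by (auto elim: forced_loss.cases)

lemma forced_loss_opponent:
  "forced_loss p A M t \<Longrightarrow> player p t \<notin> A \<Longrightarrow> zeck_move M K \<Longrightarrow>
    \<exists>N. zeck_move M N \<and> forced_loss p A N (t + 1)"
  by (auto elim: forced_loss.cases)

lemma winning_if_not_forced_loss:
  assumes "\<not> forced_loss p A (zeck_start n) 1" and "2 \<le> n"
  shows "has_winning_strategy n p A"
proof -
  \<comment> \<open>\<open>A\<close> only has to avoid lost positions; from a non-lost one it can,
    since otherwise rule \<open>alliance\<close> would make it lost.\<close>
  define \<sigma> :: strategy where
    "\<sigma> ps = (SOME N. zeck_move (last ps) N \<and> \<not> forced_loss p A N (int (length ps) + 1))" for ps
  have \<sigma>: "zeck_move (last ps) (\<sigma> ps) \<and> \<not> forced_loss p A (\<sigma> ps) (int (length ps) + 1)"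
    if "\<not> forced_loss p A (last ps) (int (length ps))" "player p (int (length ps)) \<in> A"
      "zeck_move (last ps) N" for ps N
    unfolding \<sigma>_def using that(1) alliance[OF that(3,2)] by - (rule someI_ex, blast)
  \<comment> \<open>The first two parts of this invariant make \<open>decomposition_or_move\<close>
    applicable with this \<open>n\<close>.\<close>
  have play: "sum_mset (last ps) = n \<and> set_mset (last ps) \<subseteq> zfib ` {1..} \<and>
      \<not> forced_loss p A (last ps) (int (length ps))"
    if "zeck_play n ps" "follows_strategy p A \<sigma> ps" for ps
    using that
  proof (induction ps rule: rev_induct)
    case Nil
    then show ?case by (simp add: zeck_play_def)
  next
    case (snoc N ps)
    show ?case
    proof (cases "ps = []")
      case True
      then have "N = zeck_start n" using snoc.prems by (simp add: zeck_play_def)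
      then show ?thesis
        using True assms by (auto simp: zeck_start_def zfib_small intro!: image_eqI[of _ _ 1])
    next
      case False
      have move: "zeck_move (last ps) N" and "zeck_play n ps"
        using snoc.prems False by (auto simp: zeck_play_def successively_append_iff)
      moreover have follows: "ps ! t = \<sigma> (take t ps)"
        if "1 \<le> t" "t < length ps" "player p (int t) \<in> A" for t
        using snoc.prems(2) that unfolding follows_strategy_def
        by (auto dest!: spec[of _ t] simp: nth_append)
      ultimately have IH: "sum_mset (last ps) = n" "set_mset (last ps) \<subseteq> zfib ` {1..}"
        "\<not> forced_loss p A (last ps) (int (length ps))"
        using snoc.IH by (auto simp: follows_strategy_def)
      have "\<not> forced_loss p A N (int (length ps) + 1)"
      proof (cases "player p (int (length ps)) \<in> A")
        case True
        then have "N = \<sigma> ps"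
          using snoc.prems(2) False unfolding follows_strategy_def
          by (auto dest!: spec[of _ "length ps"] simp: Suc_le_eq)
        then show ?thesis using \<sigma>[OF IH(3) True move] by simp
      next
        case False
        then show ?thesis using IH(3) move opponent by blast
      qed
      then show ?thesis
        using IH zeck_move_sum[OF move] zeck_move_zfib[OF move] by (simp add: add.commute)
    qed
  qed
  have "winning_strategy n p A \<sigma>"
    unfolding winning_strategy_def
  proof (intro allI impI conjI; elim conjE)
    fix ps
    assume ps: "zeck_play n ps" "follows_strategy p A \<sigma> ps"
    {
      assume "\<not> zeckendorf_decomposition n (last ps)" "player p (int (length ps)) \<in> A"
      moreover from this(1) obtain N where "zeck_move (last ps) N"
        using play[OF ps] decomposition_or_move[of "last ps"] by blast
      ultimately show "zeck_move (last ps) (\<sigma> ps)"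
        using play[OF ps] \<sigma> by blast
    }
    assume fin: "zeckendorf_decomposition n (last ps)"
    show len: "1 < length ps"
    proof (rule ccontr)
      assume "\<not> 1 < length ps"
      then have "ps = [zeck_start n]"
        using ps(1) by (cases ps) (auto simp: zeck_play_def)
      \<comment> \<open>Two ones can be merged, so the game is not over before the first
        move.\<close>
      moreover have "{#1, 1#} \<subseteq># zeck_start n"
        using assms(2) by (auto simp: zeck_start_def zfib_small subseteq_mset_def)
      ultimately show False
        using zeck_moveI[OF zeck_move_ones] decomposition_no_move[OF fin] by auto
    qed
    \<comment> \<open>A final move by an outsider would make the last position lost by
      \<open>ended\<close>, against \<open>play\<close>.\<close>
    show "player p (int (length ps - 1)) \<in> A"
      using play[OF ps] ended[of "last ps" p "int (length ps)" A] decomposition_no_move[OF fin] len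
      by (auto simp: of_nat_diff)
  qed
  then show ?thesis unfolding has_winning_strategy_def by blast
qed

lemma steal:
  assumes "\<And>k. player p k \<notin> A \<Longrightarrow> player p (k - b) \<in> A"
  shows "forced_loss p A M t \<Longrightarrow> \<not> forced_loss p A M (t - b)"
proof (induction rule: forced_loss.induct)
  case (ended M t)
  then have "player p (t - b - 1) \<in> A" using assms[of "t - 1"] by (simp add: algebra_simps)
  then show ?case using ended(1) by (auto elim: forced_loss.cases)
next
  case (alliance M N t)
  \<comment> \<open>No successor is lost in the shifted game and a move exists, so \<open>M\<close>
    is not lost there, whoever is to move.\<close>
  have IH: "\<not> forced_loss p A N (t - b + 1)" if "zeck_move M N" for N
    using alliance that by (simp add: algebra_simps)
  then show ?case
    using alliance(1) by (auto elim: forced_loss.cases)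
next
  case (opponent M N t)
  \<comment> \<open>The mover at turn \<open>t - b\<close> belongs to \<open>A\<close> and can copy
    the outsider's move to \<open>N\<close>.\<close>
  have "player p (t - b) \<in> A" using assms opponent(2) by simp
  moreover have "\<not> forced_loss p A N (t - b + 1)" using opponent by (simp add: algebra_simps)
  ultimately show ?case using opponent(1) forced_loss_alliance by blast
qed

subsection \<open>Accumulating twos\<close>

text \<open>\<open>A\<close> merges ones at each of its turns, gaining a two; any other move removes
  at most two twos. A move uses at most two ones, so \<open>2 * k\<close> ones keep the merge
  available for \<open>k\<close> turns.\<close>

lemma forced_loss_steps:
  assumes "forced_loss p A M t" "2 * k \<le> count M 1"
  shows "\<exists>N. forced_loss p A N (t + int k) \<and> count M 1 \<le> count N 1 + 2 * k \<and>
    int (count M 2) + (\<Sum>j<k. if player p (t + int j) \<in> A then 1 else - 2) \<le> int (count N 2)"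
  using assms(2)
proof (induction k)
  case 0
  then show ?case using assms(1) by auto
next
  case (Suc k)
  then obtain N where N: "forced_loss p A N (t + int k)" "count M 1 \<le> count N 1 + 2 * k"
    "int (count M 2) + (\<Sum>j<k. if player p (t + int j) \<in> A then 1 else - 2) \<le> int (count N 2)"
    by auto
  have "{#1, 1#} \<subseteq># N"
    using N(2) Suc.prems by (auto simp: subseteq_mset_def)
  \<comment> \<open>At an outsider's turn this move only shows that the game goes on, so that a lost
    successor exists.\<close>
  from zeck_moveI[OF zeck_move_ones this]
  have merge: "zeck_move N (N - {#1, 1#} + {#2#})" .
  have "\<exists>K. zeck_move N K \<and> forced_loss p A K (t + int k + 1) \<and>
      int (count N 2) + (if player p (t + int k) \<in> A then 1 else - 2) \<le> int (count K 2)"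
  proof (cases "player p (t + int k) \<in> A")
    case True
    then show ?thesis
      using forced_loss_alliance[OF N(1) True merge] merge
      by (intro exI[of _ "N - {#1, 1#} + {#2#}"]) auto
  next
    case False
    then obtain K where "zeck_move N K" "forced_loss p A K (t + int k + 1)"
      using forced_loss_opponent[OF N(1) False merge] by blast
    then show ?thesis using zeck_move_count[of N K 2] False by auto
  qed
  then obtain K where K: "zeck_move N K" "forced_loss p A K (t + int k + 1)"
    "int (count N 2) + (if player p (t + int k) \<in> A then 1 else - 2) \<le> int (count K 2)"
    by blast
  then show ?case
    using N zeck_move_count[OF K(1), of 1] by (intro exI[of _ K]) (auto simp: algebra_simps)
qed

section \<open>Turns modulo \<open>p\<close> and the balance of a full round\<close>

lemma player_mod_eq: "k mod int p = l mod int p \<Longrightarrow> player p k = player p l"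
  unfolding player_def using mod_diff_cong[of k "int p" l 1 1] by simp

lemma player_in: "1 \<le> p \<Longrightarrow> player p k \<in> {1..p}"
proof -
  assume "1 \<le> p"
  then have "0 \<le> (k - 1) mod int p" "(k - 1) mod int p < int p" by simp_all
  then show ?thesis by (auto simp: player_def)
qed

lemma int_player: "1 \<le> p \<Longrightarrow> int (player p k) = (k - 1) mod int p + 1"
  by (simp add: player_def)

lemma player_add_player:
  assumes "1 \<le> p"
  shows "player p (int (player p k) + l) = player p (k + l)"
proof (rule player_mod_eq)
  have "(int (player p k) + l) mod int p = ((l + 1) + (k - 1) mod int p) mod int p"
    by (simp add: int_player[OF assms] ac_simps)
  also have "\<dots> = (k + l) mod int p"
    by (subst mod_add_right_eq) (simp add: ac_simps)
  finally show "(int (player p k) + l) mod int p = (k + l) mod int p" .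
qed

lemma bij_betw_player:
  assumes "1 \<le> p"
  shows "bij_betw (\<lambda>j. player p (t + int j)) {..<p} {1..p}"
proof -
  have "inj_on (\<lambda>j. player p (t + int j)) {..<p}"
  proof (rule inj_onI)
    fix i j
    assume ij: "i \<in> {..<p}" "j \<in> {..<p}" and "player p (t + int i) = player p (t + int j)"
    then have "(t + int i - 1) mod int p = (t + int j - 1) mod int p"
      using int_player[OF assms] by (metis add_right_cancel)
    then have "int p dvd (int i - int j)"
      by (simp add: mod_eq_dvd_iff)
    then have "i \<noteq> j \<Longrightarrow> int p \<le> \<bar>int i - int j\<bar>"
      using dvd_imp_le_int[of "int i - int j" "int p"] by simp
    then show "i = j"
      using ij unfolding lessThan_iff by linarith
  qed
  moreover have "(\<lambda>j. player p (t + int j)) ` {..<p} \<subseteq> {1..p}"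
    using player_in[OF assms] by blast
  ultimately show ?thesis
    by (simp add: bij_betw_def card_image card_subset_eq)
qed

text \<open>Any \<open>p\<close> consecutive turns meet each player once, so the total is
  \<open>card A - 2 * (p - card A)\<close>.\<close>

lemma sum_round:
  assumes "1 \<le> p" "A \<subseteq> {1..p}"
  shows "(\<Sum>j<p. if player p (t + int j) \<in> A then 1 else - 2) = 3 * int (card A) - 2 * int p"
proof -
  have "(\<Sum>j<p. if player p (t + int j) \<in> A then 1 else - 2 :: int)
      = (\<Sum>i\<in>{1..p}. if i \<in> A then 1 else - 2)"
    by (rule sum.reindex_bij_betw[OF bij_betw_player[OF assms(1)]])
  also have "\<dots> = (\<Sum>i\<in>{1..p}. 3 * (if i \<in> A then 1 else 0) - 2)"
    by (rule sum.cong) auto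
  also have "\<dots> = 3 * (\<Sum>i\<in>{1..p}. if i \<in> A then 1 else 0) - 2 * int p"
    by (simp add: sum_subtractf sum_distrib_left)
  also have "(\<Sum>i\<in>{1..p}. if i \<in> A then 1 else 0) = int (card A)"
    using assms(2) by (simp add: sum.If_cases Int_absorb1)
  finally show ?thesis .
qed

text \<open>The two-thirds bound makes the gain of each round at least one two, at a price of at
  most \<open>2 * p\<close> ones.\<close>

lemma forced_loss_rounds:
  assumes "1 \<le> p" "A \<subseteq> {1..p}" "2 * p < 3 * card A"
    and "forced_loss p A M t" "2 * (p * r) \<le> count M 1"
  shows "\<exists>N. forced_loss p A N (t + int (p * r)) \<and> count M 1 \<le> count N 1 + 2 * (p * r) \<and>
    r \<le> count N 2"
  using assms(5)
proof (induction r)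
  case 0
  then show ?case using assms(4) by auto
next
  case (Suc r)
  then obtain N where N: "forced_loss p A N (t + int (p * r))"
    "count M 1 \<le> count N 1 + 2 * (p * r)" "r \<le> count N 2"
    by auto
  have "2 * p \<le> count N 1" using N(2) Suc.prems by simp
  from forced_loss_steps[OF N(1) this] sum_round[OF assms(1,2)] obtain K where
    "forced_loss p A K (t + int (p * r) + int p)" "count N 1 \<le> count K 1 + 2 * p"
    "int (count N 2) + (3 * int (card A) - 2 * int p) \<le> int (count K 2)"
    by auto
  then show ?case
    using N(2,3) assms(3) by (intro exI[of _ K]) (auto simp: algebra_simps)
qed

subsection \<open>Two ways to trade ones and twos for threes\<close>

lemma forced_loss_fast:
  assumes "\<And>j. j < k \<Longrightarrow> player p (t + int j) \<in> A"
    and "forced_loss p A (M + replicate_mset k 1 + replicate_mset k 2) t"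
  shows "forced_loss p A (M + replicate_mset k 3) (t + int k)"
  using assms
proof (induction k arbitrary: M)
  case 0
  then show ?case by simp
next
  case (Suc k)
  \<comment> \<open>One pair is hidden in \<open>M\<close> for the induction hypothesis and
    converted last.\<close>
  have "forced_loss p A (add_mset 1 (add_mset 2 M) + replicate_mset k 3) (t + int k)"
    using Suc.prems by (intro Suc.IH) (auto simp: add_mset_commute)
  moreover have "zeck_move (add_mset 1 (add_mset 2 M) + replicate_mset k 3)
      (M + replicate_mset (Suc k) 3)"
    using zeck_moveI[OF zeck_move_one_two, of "add_mset 1 (add_mset 2 M) + replicate_mset k 3"]
    by simp
  ultimately show ?case
    using forced_loss_alliance[of p A _ "t + int k"] Suc.prems(1)[of k] by (simp add: algebra_simps)
qed

text \<open>One additional \<open>1\<close> has to be present, as the merge \<open>1, 1 \<rightarrow> 2\<close> comes before the \<open>1\<close> is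
  given back.\<close>

lemma forced_loss_slow:
  assumes "\<And>j. j < 2 * k \<Longrightarrow> player p (t + int j) \<in> A" and "1 \<in># M"
    and "forced_loss p A (M + replicate_mset k 1 + replicate_mset k 2) t"
  shows "forced_loss p A (M + replicate_mset k 3) (t + 2 * int k)"
  using assms
proof (induction k arbitrary: M)
  case 0
  then show ?case by simp
next
  case (Suc k)
  obtain K where M: "M = add_mset 1 K"
    using Suc.prems(2) by (metis multi_member_split)
  define L where "L = K + replicate_mset k 3"
  have "forced_loss p A (add_mset 1 (add_mset 2 M) + replicate_mset k 3) (t + 2 * int k)"
    using Suc.prems by (intro Suc.IH) (auto simp: add_mset_commute)
  then have "forced_loss p A (L + {#1, 1, 2#}) (t + 2 * int k)"
    by (simp add: M L_def add_mset_commute)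
  \<comment> \<open>The moves \<open>1, 1, 2\<close> to \<open>2, 2\<close> to \<open>1, 3\<close>
    trade one pair for a three and return the spare \<open>1\<close>.\<close>
  moreover have "zeck_move (L + {#1, 1, 2#}) (L + {#2, 2#})"
    using zeck_moveI[OF zeck_move_ones, of "L + {#1, 1, 2#}"] by simp
  ultimately have "forced_loss p A (L + {#2, 2#}) (t + 2 * int k + 1)"
    using forced_loss_alliance Suc.prems(1)[of "2 * k"] by simp
  moreover have "zeck_move (L + {#2, 2#}) (L + {#1, 3#})"
    using zeck_moveI[OF zeck_move_twos, of "L + {#2, 2#}"] by simp
  ultimately have "forced_loss p A (L + {#1, 3#}) (t + 2 * int k + 1 + 1)"
    using forced_loss_alliance[of p A _ "t + 2 * int k + 1"] Suc.prems(1)[of "2 * k + 1"]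
    by (simp add: algebra_simps)
  then show ?case by (simp add: M L_def algebra_simps add_mset_commute)
qed

section \<open>Contradiction from a lost initial position\<close>

theorem theorem1p3p5:
  fixes n p b :: nat and A :: "nat set"
  assumes "p \<ge> 1"
    and "A \<subseteq> {1..p}"
    and "3 * card A > 2 * p"
    and "\<And>i. i \<in> {1..p} \<Longrightarrow> i \<notin> A \<Longrightarrow> player p (int i - int b) \<in> A"
    and "contains_consecutive p A (2 * b)"
    and "int n \<ge> 4 * int p * int b + 2 * int p - 2 * int b"
  shows "has_winning_strategy n p A"
proof (rule winning_if_not_forced_loss)
  have "b \<le> p * b" using assms(1) by simp
  moreover have "int n \<ge> 4 * int (p * b) + 2 * int p - 2 * int b" using assms(6) by simp
  ultimately show "2 \<le> n" using assms(1) by linarith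
  have shift: "player p (k - int b) \<in> A" if "player p k \<notin> A" for k
    using assms(4)[OF player_in[OF assms(1)] that] player_add_player[OF assms(1), of k "- int b"]
    by simp
  show "\<not> forced_loss p A (zeck_start n) 1"
  proof
    assume lost: "forced_loss p A (zeck_start n) 1"
    show False
    proof (cases "p = 1 \<or> b = 0")
      case True
      \<comment> \<open>Here the shift by \<open>b\<close> fixes every player, so nobody is outside
        \<open>A\<close> and stealing works with shift \<open>0\<close>.\<close>
      have "player p k \<in> A" for k
      proof (rule ccontr)
        assume "player p k \<notin> A"
        moreover from this have "player p (k - int b) \<in> A" by (rule shift)
        ultimately show False using True by (auto simp: player_def)
      qed
      then show False using steal[of p A 0 "zeck_start n" 1] lost by simp
    next
      case False
      then have "2 \<le> p" "1 \<le> b" using assms(1) by auto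
      then have "2 * b \<le> p * b" by simp
      moreover have "int n \<ge> 4 * int (p * b) + 2 * int p - 2 * int b" using assms(6) by simp
      \<comment> \<open>The budget of ones: at most \<open>2 * (p - 1)\<close> to reach the block,
        \<open>2 * (p * b)\<close> for \<open>b\<close> rounds, \<open>b\<close> for the pairs and
        one spare.\<close>
      ultimately have n: "2 * (p - 1) + 2 * (p * b) + b + 1 \<le> n"
        using \<open>2 \<le> p\<close> \<open>1 \<le> b\<close> by linarith
      obtain s0 where s0: "\<And>j. j < 2 * b \<Longrightarrow> player p (s0 + int j) \<in> A"
        using assms(5) unfolding contains_consecutive_def by auto
      \<comment> \<open>Reducing to \<open>{1..p}\<close> bounds the wait for the block by
        \<open>p - 1\<close> turns.\<close>
      define s where "s = player p s0"
      have s: "1 \<le> s" "s \<le> p" using player_in[OF assms(1), of s0] by (auto simp: s_def)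
      \<comment> \<open>After \<open>b\<close> whole rounds the same block of members is to move
        again.\<close>
      define T where "T = int s + int (p * b)"
      have block: "player p (T + int j) \<in> A" if "j < 2 * b" for j
      proof -
        have "player p (T + int j) = player p (int s + int j)"
          unfolding T_def by (rule player_mod_eq) (metis add.assoc add.commute mod_mult_self2 of_nat_mult)
        then show ?thesis
          using s0[OF that] player_add_player[OF assms(1)] by (simp add: s_def)
      qed
      have ones: "count (zeck_start n) 1 = n" by (simp add: zeck_start_def zfib_small)
      obtain M where "forced_loss p A M (1 + int (s - 1))" "n \<le> count M 1 + 2 * (s - 1)"
        using forced_loss_steps[OF lost, of "s - 1"] n s unfolding ones by force
      then have M: "forced_loss p A M (int s)" "2 * (p * b) + b + 1 \<le> count M 1"
        using n s by (auto simp: of_nat_diff)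
      then obtain N where N: "forced_loss p A N T" "b + 1 \<le> count N 1" "b \<le> count N 2"
        using forced_loss_rounds[OF assms(1-3) M(1), of b] unfolding T_def by auto
      define K where "K = N - (replicate_mset b 1 + replicate_mset b 2)"
      have "replicate_mset b 1 + replicate_mset b 2 \<subseteq># N"
        using N(2,3) by (auto simp: subseteq_mset_def)
      then have N_eq: "N = K + replicate_mset b 1 + replicate_mset b 2"
        unfolding K_def by (metis add.assoc subset_mset.diff_add)
      have "1 \<in># K" using N(2) by (simp add: K_def flip: count_greater_zero_iff)
      have "forced_loss p A (K + replicate_mset b 3) (T + int b)"
        using forced_loss_fast[of b p T A K] block N(1) N_eq by simp
      moreover have "forced_loss p A (K + replicate_mset b 3) (T + 2 * int b)"
        using forced_loss_slow[of b p T A K] block N(1) N_eq \<open>1 \<in># K\<close> by simp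
      \<comment> \<open>One position is lost at turns \<open>T + b\<close> and
        \<open>T + 2 * b\<close>, which \<open>steal\<close> forbids.\<close>
      ultimately show False
        using steal[of p A "int b" _ "T + 2 * int b"] shift by (simp add: add.commute)
    qed
  qed
qed

end
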